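(* Let $(X,\tau_1,\dots,\tau_n)$ be a saturated polytopological space. Then $\#\mathcal{KF}_n^0\leq p(n)$ and $\#\mathcal{KF}_n=2\cdot\#\mathcal{KF}_n^0\leq 2p(n)$, where $$p(n)=\frac{5}{24}n^4+\frac{37}{12}n^3+\frac{79}{24}n^2+\frac{101}{12}n+2.$$
   Context: A polytopological space $(X,\tau_1,\dots,\tau_n)$ (also called an $n$-topological space) is a set $X$ equipped with topologies $\tau_1\supseteq\tau_2\supseteq\dots\supseteq\tau_n$. It is saturated if whenever $1\leq x,y\leq n$ and $U$ is a nonempty $\tau_x$-open set, the $\tau_y$-interior of $U$ is nonempty. A set operator is a map from the power set of $X$ to itself; operators are composed by juxtaposition (rightmost applied first). For $1\leq j\leq n$, $k_j$, $i_j$ and $f_j$ denote the closure, interior and frontier operators of $\tau_j$, where $f_jA=k_jA\cap k_j(X\setminus A)$; $c$ denotes the complement operator $cA=X\setminus A$. $\mathcal{KF}_n=\mathcal{KF}_n(X,\tau_1,\dots,\tau_n)$ is the smallest monoid of set operators (under composition, containing the identity operator) containing $k_j,f_j$ ($1\leq j\leq n$) and $c$. $\mathcal{KF}_n^0=\mathcal{KF}_n^0(X,\tau_1,\dots,\tau_n)$ is the smallest monoid of set operators containing $k_j,i_j,f_j$ ($1\leq j\leq n$). $\#$ denotes cardinality.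
   Formalization: The equality #KF_n = 2·#KF_n^0 is stated for nonempty X only, since for X = ∅ there is just one set operator and both monoids have one element; both upper bounds are stated for every X. *)

theory Defs
  imports "HOL-Analysis.Abstract_Topology" "HOL-Algebra.Group"
begin

text \<open>
  The topologies are \<open>\<tau> 1, \<dots>, \<tau> n\<close>; values of \<open>\<tau>\<close> at other indices are irrelevant.
  The inclusions go from fine to coarse.
\<close>

definition polytopological_space :: "'a set \<Rightarrow> nat \<Rightarrow> (nat \<Rightarrow> 'a topology) \<Rightarrow> bool" where
  "polytopological_space X n \<tau> \<longleftrightarrow>
     1 \<le> n \<and>
     (\<forall>j\<in>{1..n}. topspace (\<tau> j) = X) \<and>
     (\<forall>j\<in>{1..<n}. {U. openin (\<tau> (Suc j)) U} \<subseteq> {U. openin (\<tau> j) U})"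

definition saturated :: "nat \<Rightarrow> (nat \<Rightarrow> 'a topology) \<Rightarrow> bool" where
  "saturated n \<tau> \<longleftrightarrow>
     (\<forall>x\<in>{1..n}. \<forall>y\<in>{1..n}. \<forall>U.
        openin (\<tau> x) U \<and> U \<noteq> {} \<longrightarrow> \<tau> y interior_of U \<noteq> {})"

text \<open>
  A set operator on \<open>X\<close> is an extensional function on \<open>Pow X\<close>, so that HOL equality of
  operators is equality of maps on the subsets of \<open>X\<close>.  The product \<open>g \<otimes> f\<close> applies \<open>f\<close> first.
\<close>

definition set_operators :: "'a set \<Rightarrow> ('a set \<Rightarrow> 'a set) monoid" where
  "set_operators X =
     \<lparr>carrier = Pow X \<rightarrow>\<^sub>E Pow X, mult = compose (Pow X), one = restrict id (Pow X)\<rparr>"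

definition closure_op :: "'a topology \<Rightarrow> 'a set \<Rightarrow> 'a set" where
  "closure_op T = (\<lambda>A\<in>Pow (topspace T). T closure_of A)"

definition interior_op :: "'a topology \<Rightarrow> 'a set \<Rightarrow> 'a set" where
  "interior_op T = (\<lambda>A\<in>Pow (topspace T). T interior_of A)"

text \<open>
  The library defines \<open>frontier_of\<close> as closure minus interior; the form
  \<open>k A \<inter> k (X - A)\<close> is the library fact \<open>frontier_of_closures\<close>.
\<close>

definition frontier_op :: "'a topology \<Rightarrow> 'a set \<Rightarrow> 'a set" where
  "frontier_op T = (\<lambda>A\<in>Pow (topspace T). T frontier_of A)"

definition complement_op :: "'a set \<Rightarrow> 'a set \<Rightarrow> 'a set" where
  "complement_op X = (\<lambda>A\<in>Pow X. X - A)"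

definition KF :: "'a set \<Rightarrow> nat \<Rightarrow> (nat \<Rightarrow> 'a topology) \<Rightarrow> ('a set \<Rightarrow> 'a set) set" where
  "KF X n \<tau> = (\<lambda>M. submonoid M (set_operators X)) hull
     ((\<lambda>j. closure_op (\<tau> j)) ` {1..n} \<union> (\<lambda>j. frontier_op (\<tau> j)) ` {1..n} \<union> {complement_op X})"

definition KF0 :: "'a set \<Rightarrow> nat \<Rightarrow> (nat \<Rightarrow> 'a topology) \<Rightarrow> ('a set \<Rightarrow> 'a set) set" where
  "KF0 X n \<tau> = (\<lambda>M. submonoid M (set_operators X)) hull
     ((\<lambda>j. closure_op (\<tau> j)) ` {1..n} \<union> (\<lambda>j. interior_op (\<tau> j)) ` {1..n} \<union>
      (\<lambda>j. frontier_op (\<tau> j)) ` {1..n})"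

definition KF_bound :: "nat \<Rightarrow> real" where
  "KF_bound n = 5/24 * real n ^ 4 + 37/12 * real n ^ 3 + 79/24 * real n ^ 2 + 101/12 * real n + 2"

text \<open>
  The generators are set operators, so the hulls above are taken over nonempty families and
  are themselves submonoids.
\<close>

lemma submonoid_set_operators_hull:
  assumes "S \<subseteq> carrier (set_operators X)"
  shows "submonoid ((\<lambda>M. submonoid M (set_operators X)) hull S) (set_operators X)"
proof -
  have "submonoid (carrier (set_operators X)) (set_operators X)"
    by unfold_locales (auto simp: set_operators_def compose_def PiE_iff)
  with assms show ?thesis
    unfolding hull_def submonoid_def by (auto simp: Inter_eq)
qed

lemma generators_in_set_operators:
  "closure_op T \<in> carrier (set_operators (topspace T))"
  "interior_op T \<in> carrier (set_operators (topspace T))"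
  "frontier_op T \<in> carrier (set_operators (topspace T))"
  "complement_op X \<in> carrier (set_operators X)"
  using closure_of_subset_topspace[of T] interior_of_subset_topspace[of T]
    frontier_of_subset_topspace[of T]
  by (auto simp: set_operators_def closure_op_def interior_op_def frontier_op_def
      complement_op_def)

lemma submonoid_KF:
  assumes "polytopological_space X n \<tau>"
  shows "submonoid (KF X n \<tau>) (set_operators X)" "submonoid (KF0 X n \<tau>) (set_operators X)"
proof -
  have X: "topspace (\<tau> j) = X" if "j \<in> {1..n}" for j
    using assms that by (simp add: polytopological_space_def)
  have "closure_op (\<tau> j) \<in> carrier (set_operators X)"
    "interior_op (\<tau> j) \<in> carrier (set_operators X)"
    "frontier_op (\<tau> j) \<in> carrier (set_operators X)" if "j \<in> {1..n}" for j
    using generators_in_set_operators(1-3)[of "\<tau> j"] X[OF that] by simp_all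
  then show "submonoid (KF X n \<tau>) (set_operators X)" "submonoid (KF0 X n \<tau>) (set_operators X)"
    unfolding KF_def KF0_def
    by (auto intro!: submonoid_set_operators_hull generators_in_set_operators(4))
qed

end

theory Submission
  imports Defs
begin

text \<open>
  In a saturated space an open set lies in the \<open>\<tau> 1\<close>-closure of each of its \<open>\<tau> y\<close>-interiors.
  Hence \<open>k\<^sub>y i\<^sub>x\<close> and \<open>i\<^sub>y k\<^sub>x\<close> do not depend on \<open>x\<close>, and \<open>i\<^sub>v k\<^sub>z f\<^sub>y\<close> depends only on \<open>v\<close> and
  vanishes when it is applied after a \<open>k\<^sub>x\<close> or \<open>i\<^sub>x\<close>, so that \<open>f\<^sub>v k\<^sub>z f\<^sub>y k\<^sub>x = k\<^sub>v k\<^sub>z f\<^sub>y k\<^sub>x\<close>.  With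
  \<open>f\<^sub>y k\<^sub>x = f\<^sub>y k\<^bsub>max x y\<^esub>\<close> and \<open>f\<^sub>y i\<^sub>x = f\<^sub>y i\<^bsub>max x y\<^esub>\<close> every word reduces to one of \<open>p(n)\<close> normal
  forms; the quartic term comes from \<open>k\<^sub>z f\<^sub>y k\<^sub>x f\<^sub>w\<close> with \<open>z \<ge> y\<close> and \<open>x \<ge> y, w\<close>.
  Since \<open>k\<^sub>j c = c i\<^sub>j\<close>, \<open>i\<^sub>j c = c k\<^sub>j\<close> and \<open>f\<^sub>j c = f\<^sub>j\<close>, complements move to the left, giving
  \<open>KF = KF0 \<union> c KF0\<close>; the union is disjoint because members of \<open>KF0\<close> fix the empty set.
\<close>

section \<open>Counting\<close>

text \<open>Finiteness is bundled with the bound because \<open>card\<close> is 0 on infinite sets.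
  The bound is real since the intermediate polynomials have fractional coefficients.\<close>

definition card_le :: "'a set \<Rightarrow> real \<Rightarrow> bool" where
  "card_le S c \<longleftrightarrow> finite S \<and> real (card S) \<le> c"

lemma card_leI: "finite S \<Longrightarrow> real (card S) = c \<Longrightarrow> card_le S c"
  by (simp add: card_le_def)

lemma card_le_mono: "card_le S c \<Longrightarrow> c \<le> d \<Longrightarrow> card_le S d"
  by (simp add: card_le_def)

lemma card_le_subset: "card_le T c \<Longrightarrow> S \<subseteq> T \<Longrightarrow> card_le S c"
  unfolding card_le_def using card_mono[of T S] finite_subset[of S T] by force

lemma card_le_Un: "card_le S c \<Longrightarrow> card_le T d \<Longrightarrow> card_le (S \<union> T) (c + d)"
  unfolding card_le_def using card_Un_le[of S T] by force

lemma card_le_image: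
  assumes "card_le S c"
  shows "card_le (f ` S) c"
  using assms card_image_le[of S f] unfolding card_le_def by force

text \<open>The constant \<open>c\<close> is independent of the upper limit, so induction on
  \<open>m\<close> applies; later \<open>c\<close> is \<open>n + 1\<close>.\<close>

lemma sum_squares_diff:
  "(\<Sum>y=1..m. (c - real y)\<^sup>2) =
     m * c\<^sup>2 - c * m * (m + 1) + m * (real m + 1) * (2 * m + 1) / 6"
  by (induction m) (simp_all add: power2_eq_square field_simps)

lemma sum_diff: "(\<Sum>y=1..m. c - real y) = m * c - m * (m + 1) / 2"
  by (induction m) (simp_all add: field_simps)

text \<open>These triples index the normal forms with one frontier between a closure
  \<open>z\<close> and an operator \<open>x\<close>, both of index at least
  \<open>y\<close>.\<close>

lemma card_le_triples:
  fixes n :: nat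
  shows "card_le (SIGMA y:{1..n}. {y..n} \<times> {y..n}) (n * (n + 1) * (2 * n + 1) / 6)"
proof (rule card_leI)
  show "finite (SIGMA y:{1..n}. {y..n} \<times> {y..n})"
    by simp
  have "real (card (SIGMA y:{1..n}. {y..n} \<times> {y..n})) = (\<Sum>y=1..n. (real n + 1 - real y)\<^sup>2)"
    by (auto simp: card_SigmaI power2_eq_square of_nat_diff add.commute intro!: sum.cong)
  also have "\<dots> = n * (n + 1) * (2 * n + 1) / 6"
    unfolding sum_squares_diff by (simp add: power2_eq_square field_simps)
  finally show "real (card (SIGMA y:{1..n}. {y..n} \<times> {y..n})) = n * (n + 1) * (2 * n + 1) / 6" .
qed

lemma card_le_pairs:
  fixes n :: nat
  shows "card_le (SIGMA x:{1..n}. {x..n}) (n * (n + 1) / 2)"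
proof (rule card_leI)
  show "finite (SIGMA x:{1..n}. {x..n})"
    by simp
  have "real (card (SIGMA x:{1..n}. {x..n})) = (\<Sum>y=1..n. real n + 1 - real y)"
    by (simp add: card_SigmaI of_nat_diff algebra_simps)
  also have "\<dots> = n * (n + 1) / 2"
    unfolding sum_diff by (simp add: field_simps)
  finally show "real (card (SIGMA x:{1..n}. {x..n})) = n * (n + 1) / 2" .
qed

lemma card_le_triples_strict:
  fixes n :: nat
  shows "card_le (SIGMA y:{1..n}. {y..n} \<times> {y<..n})
    (n * (n + 1) * (2 * n + 1) / 6 - n * (n + 1) / 2)"
proof (rule card_leI)
  show "finite (SIGMA y:{1..n}. {y..n} \<times> {y<..n})"
    by simp
  have "real (card (SIGMA y:{1..n}. {y..n} \<times> {y<..n})) =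
    (\<Sum>y=1..n. real (Suc n - y) * real (n - y))"
    by (simp add: card_SigmaI)
  also have "\<dots> = (\<Sum>y=1..n. (real n + 1 - real y)\<^sup>2 - (real n + 1 - real y))"
    by (intro sum.cong) (auto simp: of_nat_diff power2_eq_square algebra_simps)
  also have "\<dots> = n * (n + 1) * (2 * n + 1) / 6 - n * (n + 1) / 2"
    unfolding sum_subtractf[of "\<lambda>y. (real n + 1 - real y)\<^sup>2"] sum_squares_diff sum_diff
    by (simp add: power2_eq_square field_simps)
  finally show "real (card (SIGMA y:{1..n}. {y..n} \<times> {y<..n})) =
    n * (n + 1) * (2 * n + 1) / 6 - n * (n + 1) / 2" .
qed

text \<open>Indices of \<open>K z (F y (K x (F w A)))\<close>: for fixed \<open>x\<close>, the
  choice of \<open>w\<close> is independent of that of the pair \<open>(y, z)\<close> and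
  contributes a factor \<open>x\<close>.\<close>

lemma card_le_quadruples:
  fixes n :: nat
  shows "card_le (SIGMA x:{1..n}. {1..x} \<times> (SIGMA y:{1..x}. {y..n}))
    (n * (n + 1) * (5 * real n ^ 2 + 5 * n + 2) / 24)"
proof (rule card_leI)
  show "finite (SIGMA x:{1..n}. {1..x} \<times> (SIGMA y:{1..x}. {y..n}))"
    by simp
  have inner: "real (card (SIGMA y:{1..x}. {y..n})) = x * (real n + 1) - x * (x + 1) / 2"
    if "x \<in> {1..n}" for x
  proof -
    have "real (card (SIGMA y:{1..x}. {y..n})) = (\<Sum>y=1..x. real n + 1 - real y)"
      using that by (simp add: card_SigmaI of_nat_diff algebra_simps)
    then show ?thesis
      unfolding sum_diff .
  qed
  \<comment> \<open>The number \<open>n\<close> occurs both as upper limit and in the summand; the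
    induction must vary only the former.\<close>
  have sum: "(\<Sum>x=1..m. real x * (x * c - x * (x + 1) / 2)) =
      c * m * (m + 1) * (2 * m + 1) / 6 -
      (real m ^ 2 * (m + 1) ^ 2 / 4 + m * (m + 1) * (2 * m + 1) / 6) / 2" for m :: nat and c :: real
    by (induction m) (simp_all add: power2_eq_square field_simps)
  have "real (card (SIGMA x:{1..n}. {1..x} \<times> (SIGMA y:{1..x}. {y..n}))) =
    (\<Sum>x=1..n. real x * real (card (SIGMA y:{1..x}. {y..n})))"
    by (simp add: card_SigmaI card_cartesian_product)
  also have "\<dots> = (\<Sum>x=1..n. real x * (x * (real n + 1) - x * (x + 1) / 2))"
    by (intro sum.cong) (simp_all only: inner of_nat_mult of_nat_add of_nat_1)
  also have "\<dots> = n * (n + 1) * (5 * real n ^ 2 + 5 * n + 2) / 24"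
    unfolding sum by (simp add: power2_eq_square field_simps)
  finally show "real (card (SIGMA x:{1..n}. {1..x} \<times> (SIGMA y:{1..x}. {y..n}))) =
    n * (n + 1) * (5 * real n ^ 2 + 5 * n + 2) / 24" .
qed

section \<open>Hulls in the monoid of set operators\<close>

lemma monoid_set_operators: "monoid (set_operators X)"
  by (rule monoidI) (auto simp: set_operators_def compose_def fun_eq_iff PiE_iff extensional_def)

text \<open>The elements \<open>g\<close> with \<open>g \<otimes> t \<in> N\<close> for all
  \<open>t \<in> N\<close> form a submonoid containing \<open>S\<close>, hence the hull; evaluating
  at the unit puts \<open>g\<close> itself into \<open>N\<close>. Only absorption of generators has
  to be checked, not closure of \<open>N\<close> under products.\<close>

lemma submonoid_hull_subset:
  fixes G (structure)
  assumes "monoid G" and "\<one> \<in> N" and "N \<subseteq> carrier G" and "S \<subseteq> carrier G"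
    and absorb: "\<And>s t. s \<in> S \<Longrightarrow> t \<in> N \<Longrightarrow> s \<otimes> t \<in> N"
  shows "(\<lambda>M. submonoid M G) hull S \<subseteq> N"
proof
  interpret monoid G by fact
  fix g assume g: "g \<in> (\<lambda>M. submonoid M G) hull S"
  let ?M = "{g \<in> carrier G. \<forall>t\<in>N. g \<otimes> t \<in> N}"
  have "submonoid ?M G"
    using assms(3) by unfold_locales (auto simp: m_assoc subset_iff)
  then have "(\<lambda>M. submonoid M G) hull S \<subseteq> ?M"
    using assms(4) absorb by (intro hull_minimal) auto
  then have "g \<in> carrier G" "g \<otimes> \<one> \<in> N"
    using g assms(2) by auto
  then show "g \<in> N"
    by simp
qed

section \<open>Closure, interior and frontier in saturated polytopological spaces\<close>

locale saturated_polytopology =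
  fixes X :: "'a set" and n :: nat and \<tau> :: "nat \<Rightarrow> 'a topology"
  assumes polytopological: "polytopological_space X n \<tau>"
    and saturated: "saturated n \<tau>"
begin

abbreviation K :: "nat \<Rightarrow> 'a set \<Rightarrow> 'a set" where "K j A \<equiv> \<tau> j closure_of A"
abbreviation I :: "nat \<Rightarrow> 'a set \<Rightarrow> 'a set" where "I j A \<equiv> \<tau> j interior_of A"
abbreviation F :: "nat \<Rightarrow> 'a set \<Rightarrow> 'a set" where "F j A \<equiv> \<tau> j frontier_of A"

section \<open>Order of the topologies and duality under complement\<close>

lemma n_pos: "1 \<le> n"
  using polytopological by (simp add: polytopological_space_def)

lemma n_index: "n \<in> {1..n}"
  using n_pos by simp

lemma topspace_eq: "j \<in> {1..n} \<Longrightarrow> topspace (\<tau> j) = X"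
  using polytopological by (simp add: polytopological_space_def)

lemma openin_mono:
  assumes "openin (\<tau> y) U" "1 \<le> x" "x \<le> y" "y \<le> n"
  shows "openin (\<tau> x) U"
  using assms(3,1,2,4)
proof (induction y rule: dec_induct)
  case (step j)
  then show ?case
    using polytopological unfolding polytopological_space_def by fastforce
qed

lemma closedin_mono:
  assumes "closedin (\<tau> y) C" "1 \<le> x" "x \<le> y" "y \<le> n"
  shows "closedin (\<tau> x) C"
  using assms openin_mono[of y "X - C" x] topspace_eq[of x] topspace_eq[of y]
  by (auto simp: closedin_def)

lemma closure_subset_closure:
  assumes "1 \<le> x" "x \<le> y" "y \<le> n"
  shows "K x A \<subseteq> K y A"
proof -
  \<comment> \<open>\<open>A\<close> may stick out of \<open>X\<close>; only its trace on
    \<open>X\<close> is contained in \<open>K y A\<close>.\<close>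
  have "K x (X \<inter> A) \<subseteq> K y A"
    using assms closedin_mono[OF closedin_closure_of assms, of A]
    by (intro closure_of_minimal)
      (metis atLeastAtMost_iff closure_of_subset_Int le_trans topspace_eq)
  then show ?thesis
    using assms closure_of_restrict[of "\<tau> x" A] topspace_eq[of x] by simp
qed

lemma interior_subset_interior:
  assumes "1 \<le> x" "x \<le> y" "y \<le> n"
  shows "I y A \<subseteq> I x A"
  using assms openin_mono[OF openin_interior_of assms]
  by (intro interior_of_maximal interior_of_subset)

lemma interior_compl: "j \<in> {1..n} \<Longrightarrow> I j (X - A) = X - K j A"
  using interior_of_complement[of "\<tau> j" A] by (simp add: topspace_eq)

lemma closure_compl: "j \<in> {1..n} \<Longrightarrow> K j (X - A) = X - I j A"
  using closure_of_complement[of "\<tau> j" A] by (simp add: topspace_eq)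

lemma frontier_compl: "j \<in> {1..n} \<Longrightarrow> F j (X - A) = F j A"
  using frontier_of_complement[of "\<tau> j" A] by (simp add: topspace_eq)

lemma interior_eq: "j \<in> {1..n} \<Longrightarrow> I j A = X - K j (X - A)"
  using interior_of_closure_of[of "\<tau> j" A] by (simp add: topspace_eq)

text \<open>For \<open>x \<le> y\<close> the set \<open>K y A\<close> is already closed in the finer
  topology. Otherwise \<open>K y A\<close> lies between \<open>X \<inter> A\<close> and
  \<open>K x A\<close>.\<close>

lemma closure_closure:
  assumes "x \<in> {1..n}" "y \<in> {1..n}"
  shows "K x (K y A) = K (max x y) A"
proof (cases "x \<le> y")
  case True
  then show ?thesis
    using assms closedin_mono[OF closedin_closure_of, of x y A]
    by (simp add: closure_of_eq max_def)
next
  case False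
  have "K x (K y A) \<subseteq> K x A"
    using False assms closure_of_mono[OF closure_subset_closure[of y x A], of "\<tau> x"] by simp
  moreover have "K x A \<subseteq> K x (K y A)"
    using closure_of_mono[OF closure_of_subset_Int[of "\<tau> y" A], of "\<tau> x"]
      closure_of_restrict[of "\<tau> x" A] assms by (simp add: topspace_eq)
  ultimately show ?thesis
    using False by (simp add: max_def)
qed

lemma interior_interior:
  assumes "x \<in> {1..n}" "y \<in> {1..n}"
  shows "I x (I y A) = I (max x y) A"
proof -
  have "max x y \<in> {1..n}"
    using assms by auto
  then show ?thesis
    using assms closure_closure[OF assms, of "X - A"]
    by (simp add: interior_eq[of y] interior_compl interior_eq[of "max x y"])
qed

section \<open>Consequences of saturation\<close>

text \<open>This is where saturation enters. The part \<open>?V\<close> of \<open>U\<close> outside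
  the closure is open in the finest topology; if nonempty, it has a nonempty
  \<open>\<tau> y\<close>-interior, which lies in \<open>I y U\<close> and so in the closure that
  \<open>?V\<close> avoids.\<close>

lemma open_subset_closure_interior:
  assumes "openin (\<tau> x) U" "x \<in> {1..n}" "y \<in> {1..n}"
  shows "U \<subseteq> K 1 (I y U)"
proof (rule ccontr)
  let ?V = "U - K 1 (I y U)"
  assume "\<not> U \<subseteq> K 1 (I y U)"
  moreover have "openin (\<tau> 1) ?V"
    using assms openin_mono[of x U 1] by (auto intro: openin_diff)
  ultimately have "I y ?V \<noteq> {}"
    using saturated assms n_pos unfolding saturated_def
    by (metis Diff_eq_empty_iff atLeastAtMost_iff order_refl)
  moreover have "I y ?V \<subseteq> I y U" "I y ?V \<subseteq> ?V"
    by (auto intro!: interior_of_mono interior_of_subset)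
  moreover have "I y U \<subseteq> K 1 (I y U)"
    using assms n_pos interior_of_subset_topspace[of "\<tau> y" U]
    by (intro closure_of_subset) (simp add: topspace_eq)
  ultimately show False
    by blast
qed

text \<open>\<open>I 1 A\<close> is the largest of the interiors, and it lies in the
  \<open>\<tau> 1\<close>-closure of each \<open>I x A\<close>; applying \<open>K y\<close> absorbs
  \<open>K 1\<close>.\<close>

lemma closure_interior:
  assumes "x \<in> {1..n}" "y \<in> {1..n}"
  shows "K y (I x A) = K y (I n A)"
proof -
  have *: "K y (I 1 A) = K y (I x A)" if x: "x \<in> {1..n}" for x
  proof
    have "I 1 A \<subseteq> K 1 (I x (I 1 A))"
      using open_subset_closure_interior[of 1 "I 1 A" x] x n_pos by simp
    also have "\<dots> = K 1 (I x A)"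
      using x n_pos by (simp add: interior_interior)
    finally have "K y (I 1 A) \<subseteq> K y (K 1 (I x A))"
      by (rule closure_of_mono)
    also have "\<dots> = K y (I x A)"
      using assms n_pos by (simp add: closure_closure)
    finally show "K y (I 1 A) \<subseteq> K y (I x A)" .
    show "K y (I x A) \<subseteq> K y (I 1 A)"
      using x by (intro closure_of_mono interior_subset_interior) auto
  qed
  show ?thesis
    using *[OF assms(1)] *[OF n_index] by simp
qed

lemma interior_closure:
  assumes "x \<in> {1..n}" "y \<in> {1..n}"
  shows "I y (K x A) = I y (K n A)"
proof -
  have *: "I y (K x A) = X - K y (I x (X - A))" if "x \<in> {1..n}" for x
    using that assms by (simp add: interior_eq[of y] interior_compl)
  show ?thesis
    using *[OF assms(1)] *[OF n_index] closure_interior[OF assms] by simp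
qed

text \<open>The classical identity \<open>ikik = ik\<close> with an arbitrary outer index.\<close>

lemma interior_closure_interior_closure:
  assumes "v \<in> {1..n}"
  shows "I v (K n (I n (K n A))) = I v (K n A)"
proof
  have "K n (I n (K n A)) \<subseteq> K n (K n A)"
    by (intro closure_of_mono interior_of_subset)
  then show "I v (K n (I n (K n A))) \<subseteq> I v (K n A)"
    by (simp add: interior_of_mono)
  \<comment> \<open>The interior \<open>I n\<close> absorbs \<open>I v\<close> because
    \<open>v \<le> n\<close>.\<close>
  have "I v (K n A) \<subseteq> K 1 (I n (I v (K n A)))"
    using assms n_index by (intro open_subset_closure_interior) auto
  also have "\<dots> \<subseteq> K n (I n (K n A))"
    using assms n_pos closure_subset_closure[of 1 n] by (simp add: interior_interior)
  finally show "I v (K n A) \<subseteq> I v (K n (I n (K n A)))"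
    by (simp add: interior_of_maximal)
qed

lemma closure_interior_closure_interior:
  assumes "v \<in> {1..n}"
  shows "K v (I n (K n (I n A))) = K v (I n A)"
proof -
  have *: "K v (I n B) = X - I v (K n (X - B))" for B
    using assms n_index interior_eq[of n B] closure_compl[of v "K n (X - B)"] by simp
  have "X - K n (I n A) = I n (K n (X - A))"
    using n_index interior_compl[of n "I n A"] closure_compl[of n A] by simp
  then show ?thesis
    using interior_closure_interior_closure[OF assms, of "X - A"] by (simp add: *)
qed

section \<open>Frontiers combined with closures and interiors\<close>

lemma interior_closure_frontier:
  assumes "v \<in> {1..n}" "y \<in> {1..n}" "z \<in> {1..n}"
  shows "I v (K z (F y A)) = I v (K n A) \<inter> I v (K n (X - A))"
proof -
  \<comment> \<open>Under \<open>I v\<close> the closure \<open>K z\<close> may be traded for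
    \<open>K y\<close>, which fixes the closed set \<open>F y A\<close>.\<close>
  have "I v (K z (F y A)) = I v (K y (F y A))"
    using assms interior_closure[of z v] interior_closure[of y v] by metis
  also have "\<dots> = I v (F y A)"
    by (simp add: closedin_frontier_of closure_of_closedin)
  also have "\<dots> = I v (K y A \<inter> K y (X - A))"
    using assms by (simp add: frontier_of_closures topspace_eq)
  also have "\<dots> = I v (K n A) \<inter> I v (K n (X - A))"
    using assms interior_closure[of y v] by (simp add: interior_of_Int)
  finally show ?thesis .
qed

lemma interior_closure_frontier_eq:
  assumes "v \<in> {1..n}" "y \<in> {1..n}" "z \<in> {1..n}"
  shows "I v (K z (F y A)) = I v (K n (F n A))"
  using interior_closure_frontier assms n_index by simp

text \<open>Of the two sets whose intersection is the left side, one lies in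
  \<open>K v (I n (K n A))\<close> and the other is its complement. So \<open>F y (K x A)\<close> is
  nowhere dense for every topology of the family.\<close>

lemma interior_closure_frontier_closure:
  assumes "v \<in> {1..n}" "x \<in> {1..n}" "y \<in> {1..n}" "z \<in> {1..n}"
  shows "I v (K z (F y (K x A))) = {}"
proof -
  have "K n (X - K x A) = X - I n (K n A)"
    using assms n_index interior_closure[of x n A] by (simp add: closure_compl)
  then have "I v (K n (X - K x A)) = X - K v (I n (K n A))"
    using assms by (simp add: interior_compl)
  moreover have "I v (K n A) \<subseteq> K v (I n (K n A))"
  proof -
    have "I v (K n A) \<subseteq> K v (I v (K n A))"
      by (intro closure_of_subset interior_of_subset_topspace)
    then show ?thesis
      using assms closure_interior[of v v] by simp
  qed
  moreover have "K n (K x A) = K n A"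
    using assms n_index by (simp add: closure_closure max_absorb1)
  ultimately show ?thesis
    unfolding interior_closure_frontier[OF assms(1,3,4)] by auto
qed

lemma interior_closure_frontier_interior:
  assumes "v \<in> {1..n}" "x \<in> {1..n}" "y \<in> {1..n}" "z \<in> {1..n}"
  shows "I v (K z (F y (I x A))) = {}"
  using interior_closure_frontier_closure[OF assms, of "X - A"]
  by (simp only: interior_eq[OF assms(2)] frontier_compl[OF assms(3)])

text \<open>In \<open>F y = K y - I y\<close>, the closure part merges the indices to their maximum
  and the interior part ignores \<open>x\<close>. Hence only inner indices at least \<open>y\<close>
  are needed in normal forms.\<close>

lemma frontier_closure:
  assumes "x \<in> {1..n}" "y \<in> {1..n}"
  shows "F y (K x A) = F y (K (max x y) A)"
proof -
  have "max x y \<in> {1..n}"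
    using assms by auto
  then show ?thesis
    using assms interior_closure[of x y A] interior_closure[of "max x y" y A]
    by (simp add: frontier_of_def closure_closure max.commute)
qed

lemma frontier_interior:
  assumes "x \<in> {1..n}" "y \<in> {1..n}"
  shows "F y (I x A) = F y (I (max x y) A)"
proof -
  have "max x y \<in> {1..n}"
    using assms by auto
  then show ?thesis
    using assms closure_interior[of x y A] closure_interior[of "max x y" y A]
    by (simp add: frontier_of_def interior_interior max.commute)
qed

text \<open>Both sides equal \<open>K y (I n (K n A)) - I y (K n A)\<close>.\<close>

lemma frontier_interior_closure:
  assumes "y \<in> {1..n}"
  shows "F y (I y (K n A)) = F y (K y (I n (K n A)))"
proof -
  have "I y (K y (I n (K n A))) = I y (K n A)"
    using assms interior_closure[of y y] by (simp add: interior_closure_interior_closure)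
  then show ?thesis
    using assms closure_interior[of y y] by (simp add: frontier_of_def)
qed

lemma closure_frontier: "K y (F y A) = F y A"
  by (simp add: closedin_frontier_of closure_of_closedin)

text \<open>With empty interior, the frontier is the whole closure; this stops words from growing
  under further frontiers.\<close>

lemma frontier_closure_nowhere_dense:
  assumes "v \<in> {1..n}" "z \<in> {1..n}" "I v (K z D) = {}"
  shows "F v (K z D) = K (max v z) D"
  using assms by (simp add: frontier_of_def closure_closure)

section \<open>A finite set of operators absorbing the generators from the left\<close>

text \<open>
  The index \<open>n\<close> is a mere representative: these operators do not change when it is replaced.  The
  range \<open>{y<..n}\<close> in \<open>fkik\<close> avoids counting \<open>f\<^sub>y i\<^sub>y k = f\<^sub>y k\<^sub>y i k\<close> twice.
\<close>

inductive_set tails :: "('a set \<Rightarrow> 'a set) \<Rightarrow> ('a set \<Rightarrow> 'a set) set" for E where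
  ik: "(\<lambda>A. I x (K n (E A))) \<in> tails E" if "x \<in> {1..n}"
| kik: "(\<lambda>A. K x (I n (K n (E A)))) \<in> tails E" if "x \<in> {1..n}"
| fik: "(\<lambda>A. K z (F y (I x (K n (E A))))) \<in> tails E"
    if "y \<in> {1..n}" "z \<in> {y..n}" "x \<in> {y..n}"
| fkik: "(\<lambda>A. K z (F y (K x (I n (K n (E A)))))) \<in> tails E"
    if "y \<in> {1..n}" "z \<in> {y..n}" "x \<in> {y<..n}"

text \<open>The normal forms. A frontier is stored as \<open>K z (F y _)\<close> with
  \<open>z \<ge> y\<close>; the case \<open>z = y\<close> is the bare frontier. In
  \<open>fkf\<close>, \<open>w \<le> x\<close> holds because \<open>K x\<close> follows the closed
  set \<open>F w A\<close>, and \<open>y \<le> x\<close> by \<open>frontier_closure\<close>. The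
  \<open>E\<close> in \<open>tails\<close> is the part applied first.\<close>

inductive_set words :: "('a set \<Rightarrow> 'a set) set" where
  id: "(\<lambda>A. A) \<in> words"
| empty: "(\<lambda>A. {}) \<in> words"
| i: "(\<lambda>A. I x A) \<in> words" if "x \<in> {1..n}"
| k: "(\<lambda>A. K x A) \<in> words" if "x \<in> {1..n}"
| f: "(\<lambda>A. K y (F x A)) \<in> words" if "x \<in> {1..n}" "y \<in> {x..n}"
| fk: "(\<lambda>A. K z (F y (K x A))) \<in> words" if "y \<in> {1..n}" "z \<in> {y..n}" "x \<in> {y..n}"
| fi: "(\<lambda>A. K z (F y (I x A))) \<in> words" if "y \<in> {1..n}" "z \<in> {y..n}" "x \<in> {y..n}"
| fkf: "(\<lambda>A. K z (F y (K x (F w A)))) \<in> words"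
    if "x \<in> {1..n}" "w \<in> {1..x}" "y \<in> {1..x}" "z \<in> {y..n}"
| tails: "g \<in> words" if "g \<in> tails E" "E \<in> {\<lambda>A. A, I n, F n}"

text \<open>Readmits the diagonal \<open>x = y\<close> left out of \<open>fkik\<close>, where the
  operator is already a \<open>fik\<close> form.\<close>

lemma fkik_tails:
  assumes "y \<in> {1..n}" "z \<in> {y..n}" "x \<in> {y..n}"
  shows "(\<lambda>A. K z (F y (K x (I n (K n (E A)))))) \<in> tails E"
proof (cases "x = y")
  case True
  then show ?thesis
    using tails.fik[of y z y E] assms by (simp add: frontier_interior_closure)
next
  case False
  then show ?thesis
    using assms by (intro tails.fkik) auto
qed

text \<open>On \<open>ik\<close> and \<open>kik\<close> the generators merge indices or add a
  frontier. The other two forms have nowhere dense values, so interiors give the empty set and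
  frontiers act as closures.\<close>

lemma tails_absorb:
  assumes "g \<in> tails E" "v \<in> {1..n}"
  shows "(\<lambda>A. K v (g A)) \<in> tails E" "(\<lambda>A. I v (g A)) \<in> insert (\<lambda>A. {}) (tails E)"
    "(\<lambda>A. F v (g A)) \<in> tails E"
proof -
  have v: "max v x \<in> {1..n}" "max x v \<in> {1..n}" "max x v \<in> {v..n}" if "x \<in> {1..n}" for x
    using that assms(2) by auto
  from assms(1) have "(\<lambda>A. K v (g A)) \<in> tails E \<and> (\<lambda>A. I v (g A)) \<in> insert (\<lambda>A. {}) (tails E) \<and>
    (\<lambda>A. F v (g A)) \<in> tails E"
  proof cases
    case (ik x)
    \<comment> \<open>The outer \<open>K v\<close> changes nothing; it supplies the leading closure
      of the normal form.\<close>
    have "(\<lambda>A. F v (g A)) = (\<lambda>A. K v (F v (I (max x v) (K n (E A)))))"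
      using frontier_interior[OF ik(2) assms(2)] by (simp add: closure_frontier ik(1))
    moreover have "(\<lambda>A. K v (g A)) = (\<lambda>A. K v (I n (K n (E A))))"
      using closure_interior[OF ik(2) assms(2)] by (simp add: ik(1))
    ultimately show ?thesis
      using ik v[OF ik(2)] assms(2)
        tails.ik[where E = E] tails.kik[where E = E] tails.fik[where E = E] fkik_tails[where E = E]
      by (simp add: interior_interior)
  next
    case (kik x)
    have "(\<lambda>A. F v (g A)) = (\<lambda>A. K v (F v (K (max x v) (I n (K n (E A))))))"
      using frontier_closure[OF kik(2) assms(2)] by (simp add: closure_frontier kik(1))
    moreover have "(\<lambda>A. I v (g A)) = (\<lambda>A. I v (K n (E A)))"
      using interior_closure[OF kik(2) assms(2)] assms(2)
      by (simp add: kik(1) interior_closure_interior_closure)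
    ultimately show ?thesis
      using kik v[OF kik(2)] assms(2)
        tails.ik[where E = E] tails.kik[where E = E] tails.fik[where E = E] fkik_tails[where E = E]
      by (simp add: closure_closure)
  next
    case (fik y z x)
    then have z: "x \<in> {1..n}" "z \<in> {1..n}" "max v z \<in> {y..n}"
      using assms(2) by auto
    show ?thesis
      using fik z assms(2) tails.fik[where E = E]
      by (simp add: closure_closure interior_closure_frontier_interior frontier_closure_nowhere_dense)
  next
    case (fkik y z x)
    then have z: "x \<in> {1..n}" "z \<in> {1..n}" "max v z \<in> {y..n}"
      using assms(2) by auto
    show ?thesis
      using fkik z assms(2) fkik_tails[where E = E]
      by (simp add: closure_closure interior_closure_frontier_closure frontier_closure_nowhere_dense)
  qed
  then show "(\<lambda>A. K v (g A)) \<in> tails E" "(\<lambda>A. I v (g A)) \<in> insert (\<lambda>A. {}) (tails E)"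
    "(\<lambda>A. F v (g A)) \<in> tails E"
    by blast+
qed

lemma words_absorb:
  assumes "g \<in> words" "v \<in> {1..n}"
  shows "(\<lambda>A. K v (g A)) \<in> words \<and> (\<lambda>A. I v (g A)) \<in> words \<and> (\<lambda>A. F v (g A)) \<in> words"
proof -
  have v: "max v x \<in> {1..n}" "max x v \<in> {1..n}" "max x v \<in> {v..n}" if "x \<in> {1..n}" for x
    using that assms(2) by auto
  from assms(1) show ?thesis
  proof cases
    case id
    then show ?thesis
      using words.i words.k words.f[of v v] assms(2) by (simp add: closure_frontier)
  next
    case empty
    then show ?thesis
      using words.empty by simp
  next
    case (i x)
    \<comment> \<open>Expanding \<open>ki\<close> to \<open>kiki\<close> makes it a
      \<open>kik\<close> tail with \<open>E = I n\<close>.\<close>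
    have "(\<lambda>A. K v (g A)) = (\<lambda>A. K v (I n (K n (I n A))))"
      using closure_interior[OF i(2) assms(2)] assms(2)
      by (simp add: i(1) closure_interior_closure_interior)
    moreover have "(\<lambda>A. F v (g A)) = (\<lambda>A. K v (F v (I (max x v) A)))"
      using frontier_interior[OF i(2) assms(2)] by (simp add: closure_frontier i(1))
    ultimately show ?thesis
      using i v[OF i(2)] assms(2) words.i words.fi words.tails[OF tails.kik[OF assms(2), of "I n"]]
      by (simp add: interior_interior)
  next
    case (k x)
    have "(\<lambda>A. I v (g A)) = (\<lambda>A. I v (K n A))"
      using interior_closure[OF k(2) assms(2)] by (simp add: k(1))
    moreover have "(\<lambda>A. F v (g A)) = (\<lambda>A. K v (F v (K (max x v) A)))"
      using frontier_closure[OF k(2) assms(2)] by (simp add: closure_frontier k(1))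
    ultimately show ?thesis
      using k v[OF k(2)] assms(2) words.k words.fk words.tails[OF tails.ik[OF assms(2), of "\<lambda>A. A"]]
      by (simp add: closure_closure)
  next
    case (f x y)
    then have y: "y \<in> {1..n}" "max v y \<in> {x..n}" "x \<in> {1..max y v}" "v \<in> {1..max y v}"
      using assms(2) by auto
    have "(\<lambda>A. I v (g A)) = (\<lambda>A. I v (K n (F n A)))"
      using interior_closure_frontier_eq[OF assms(2) f(2) y(1)] by (simp add: f(1))
    then have "(\<lambda>A. I v (g A)) \<in> words"
      using words.tails[OF tails.ik[OF assms(2), of "F n"]] by simp
    \<comment> \<open>The source of the four-index words: \<open>max y v\<close> bounds both
      frontier indices \<open>x\<close> and \<open>v\<close>.\<close>
    moreover have "(\<lambda>A. F v (g A)) = (\<lambda>A. K v (F v (K (max y v) (F x A))))"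
      using frontier_closure[OF y(1) assms(2)] by (simp add: closure_frontier f(1))
    then have "(\<lambda>A. F v (g A)) \<in> words"
      using words.fkf[OF v(2)[OF y(1)] y(3,4), of v] assms(2) by simp
    moreover have "(\<lambda>A. K v (g A)) \<in> words"
      using words.f[OF f(2) y(2)] y(1) assms(2) by (simp add: f(1) closure_closure)
    ultimately show ?thesis
      by blast
  next
    case (fk y z x)
    then have z: "x \<in> {1..n}" "z \<in> {1..n}" "max v z \<in> {y..n}"
      using assms(2) by auto
    show ?thesis
      using fk z assms(2) words.empty words.fk
      by (simp add: closure_closure interior_closure_frontier_closure frontier_closure_nowhere_dense)
  next
    case (fi y z x)
    then have z: "x \<in> {1..n}" "z \<in> {1..n}" "max v z \<in> {y..n}"
      using assms(2) by auto
    show ?thesis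
      using fi z assms(2) words.empty words.fi
      by (simp add: closure_closure interior_closure_frontier_interior frontier_closure_nowhere_dense)
  next
    case (fkf x w y z)
    then have z: "y \<in> {1..n}" "z \<in> {1..n}" "max v z \<in> {y..n}"
      using assms(2) by auto
    show ?thesis
      using fkf z assms(2) words.empty words.fkf
      by (simp add: closure_closure interior_closure_frontier_closure frontier_closure_nowhere_dense)
  next
    case (tails E)
    have sub: "insert (\<lambda>A. {}) (tails E) \<subseteq> words"
      by (intro insert_subsetI words.empty subsetI words.tails[OF _ tails(2)])
    show ?thesis
      by (intro conjI words.tails[OF _ tails(2)] tails_absorb(1,3)[OF tails(1) assms(2)]
          subsetD[OF sub tails_absorb(2)[OF tails(1) assms(2)]])
  qed
qed

section \<open>The bound for \<open>KF0\<close>\<close>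

lemma card_le_tails:
  "card_le (tails E) (2 * n + n * (n + 1) * (2 * n + 1) / 3 - n * (n + 1) / 2)"
proof -
  let ?T = "SIGMA y:{1..n}. {y..n} \<times> {y..n}" and ?T' = "SIGMA y:{1..n}. {y..n} \<times> {y<..n}"
  let ?S = "(\<lambda>x A. I x (K n (E A))) ` {1..n} \<union> (\<lambda>x A. K x (I n (K n (E A)))) ` {1..n} \<union>
    (\<lambda>(y, z, x) A. K z (F y (I x (K n (E A))))) ` ?T \<union>
    (\<lambda>(y, z, x) A. K z (F y (K x (I n (K n (E A)))))) ` ?T'"
  have "card_le {1..n} (real n)" "card_le ?T (n * (n + 1) * (2 * n + 1) / 6)"
    "card_le ?T' (n * (n + 1) * (2 * n + 1) / 6 - n * (n + 1) / 2)"
    by (simp_all only: card_le_triples card_le_triples_strict) (simp add: card_le_def)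
  then have "card_le ?S (real n + real n + n * (n + 1) * (2 * n + 1) / 6 +
      (n * (n + 1) * (2 * n + 1) / 6 - n * (n + 1) / 2))"
    by (intro card_le_Un card_le_image)
  moreover have "tails E \<subseteq> ?S"
  proof
    fix g assume "g \<in> tails E"
    then show "g \<in> ?S"
    proof cases
      case (fik y z x)
      then show ?thesis
        by (intro UnI1[OF UnI2] image_eqI[of _ _ "(y, z, x)"]) auto
    next
      case (fkik y z x)
      then show ?thesis
        by (intro UnI2 image_eqI[of _ _ "(y, z, x)"]) auto
    qed simp_all
  qed
  ultimately show ?thesis
    by (rule card_le_mono[OF card_le_subset]) simp
qed

text \<open>With \<open>?t\<close> triples, \<open>?p\<close> pairs and \<open>q\<close> quadruples
  the total is \<open>2 + 2n + ?p + 2 ?t + q + 3 (2n + 2 ?t - ?p)\<close>, the last term being the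
  three families of tails. This is exactly \<open>KF_bound n\<close>.\<close>

lemma card_le_words: "card_le words (KF_bound n)"
proof -
  let ?T = "SIGMA y:{1..n}. {y..n} \<times> {y..n}"
    and ?Q = "SIGMA x:{1..n}. {1..x} \<times> (SIGMA y:{1..x}. {y..n})"
  let ?S = "{\<lambda>A. A, \<lambda>A. {}} \<union> I ` {1..n} \<union> K ` {1..n} \<union>
    (\<lambda>(x, y) A. K y (F x A)) ` (SIGMA x:{1..n}. {x..n}) \<union>
    (\<lambda>(y, z, x) A. K z (F y (K x A))) ` ?T \<union> (\<lambda>(y, z, x) A. K z (F y (I x A))) ` ?T \<union>
    (\<lambda>(x, w, y, z) A. K z (F y (K x (F w A)))) ` ?Q \<union>
    (tails (\<lambda>A. A) \<union> tails (I n) \<union> tails (F n))"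
  let ?t = "n * (n + 1) * (2 * n + 1) / 6" and ?p = "n * (n + 1) / 2"
  let ?e = "2 * n + n * (n + 1) * (2 * n + 1) / 3 - n * (n + 1) / 2"
  have "card_le {1..n} (real n)" "card_le (SIGMA x:{1..n}. {x..n}) ?p" "card_le ?T ?t"
    "card_le ?Q (n * (n + 1) * (5 * real n ^ 2 + 5 * n + 2) / 24)"
    by (simp_all only: card_le_triples card_le_pairs card_le_quadruples) (simp add: card_le_def)
  moreover have "card_le {\<lambda>A. A :: 'a set, \<lambda>A. {}} 2"
    unfolding card_le_def by (simp add: card_insert_if)
  ultimately have "card_le ?S (2 + real n + real n + ?p + ?t + ?t +
      n * (n + 1) * (5 * real n ^ 2 + 5 * n + 2) / 24 + (?e + ?e + ?e))"
    by (intro card_le_Un card_le_image card_le_tails)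
  moreover have "words \<subseteq> ?S"
  proof
    fix g assume "g \<in> words"
    then show "g \<in> ?S"
    proof cases
      case (f x y)
      then have "g \<in> (\<lambda>(x, y) A. K y (F x A)) ` (SIGMA x:{1..n}. {x..n})"
        by (intro image_eqI[of _ _ "(x, y)"]) auto
      then show ?thesis
        by blast
    next
      case (fk y z x)
      then have "g \<in> (\<lambda>(y, z, x) A. K z (F y (K x A))) ` ?T"
        by (intro image_eqI[of _ _ "(y, z, x)"]) auto
      then show ?thesis
        by blast
    next
      case (fi y z x)
      then have "g \<in> (\<lambda>(y, z, x) A. K z (F y (I x A))) ` ?T"
        by (intro image_eqI[of _ _ "(y, z, x)"]) auto
      then show ?thesis
        by blast
    next
      case (fkf x w y z)
      then have "g \<in> (\<lambda>(x, w, y, z) A. K z (F y (K x (F w A)))) ` ?Q"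
        by (intro image_eqI[of _ _ "(x, w, y, z)"]) auto
      then show ?thesis
        by blast
    next
      case (tails E)
      then show ?thesis
        by auto
    qed simp_all
  qed
  ultimately show ?thesis
    by (rule card_le_mono[OF card_le_subset])
      (simp add: KF_bound_def power2_eq_square power3_eq_cube power4_eq_xxxx field_simps)
qed

section \<open>From normal forms to extensional operators on \<open>Pow X\<close>\<close>

lemma words_subset:
  assumes "g \<in> words" "A \<subseteq> X"
  shows "g A \<subseteq> X"
proof -
  have sub: "K j B \<subseteq> X" "I j B \<subseteq> X" if "1 \<le> j" "j \<le> n" for j B
    using that closure_of_subset_topspace[of "\<tau> j" B] interior_of_subset_topspace[of "\<tau> j" B]
    by (simp_all add: topspace_eq)
  have "g A \<subseteq> X" if "g \<in> tails E" for E
    using that by cases (simp_all add: sub)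
  with assms show ?thesis
    by cases (auto simp: sub)
qed

lemma generators_in_carrier:
  assumes "j \<in> {1..n}"
  shows "closure_op (\<tau> j) \<in> carrier (set_operators X)"
    "interior_op (\<tau> j) \<in> carrier (set_operators X)"
    "frontier_op (\<tau> j) \<in> carrier (set_operators X)"
  using generators_in_set_operators(1-3)[of "\<tau> j"] by (simp_all add: topspace_eq[OF assms])

lemma KF0_subset_words: "KF0 X n \<tau> \<subseteq> (\<lambda>g. restrict g (Pow X)) ` words"
  unfolding KF0_def
proof (rule submonoid_hull_subset[OF monoid_set_operators])
  show "\<one>\<^bsub>set_operators X\<^esub> \<in> (\<lambda>g. restrict g (Pow X)) ` words"
    by (rule image_eqI[OF _ words.id]) (simp add: set_operators_def id_def)
  show "(\<lambda>g. restrict g (Pow X)) ` words \<subseteq> carrier (set_operators X)"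
    by (simp add: set_operators_def image_subset_iff restrict_PiE_iff words_subset)
  show "(\<lambda>j. closure_op (\<tau> j)) ` {1..n} \<union> (\<lambda>j. interior_op (\<tau> j)) ` {1..n} \<union>
      (\<lambda>j. frontier_op (\<tau> j)) ` {1..n} \<subseteq> carrier (set_operators X)"
    using generators_in_carrier by auto
next
  fix s t
  assume s: "s \<in> (\<lambda>j. closure_op (\<tau> j)) ` {1..n} \<union> (\<lambda>j. interior_op (\<tau> j)) ` {1..n} \<union>
      (\<lambda>j. frontier_op (\<tau> j)) ` {1..n}"
    and "t \<in> (\<lambda>g. restrict g (Pow X)) ` words"
  then obtain g where g: "g \<in> words" "t = restrict g (Pow X)"
    by auto
  from s consider j where "j \<in> {1..n}" "s = closure_op (\<tau> j)"
    | j where "j \<in> {1..n}" "s = interior_op (\<tau> j)"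
    | j where "j \<in> {1..n}" "s = frontier_op (\<tau> j)"
    by auto
  then obtain h where "h \<in> words" "s \<otimes>\<^bsub>set_operators X\<^esub> t = restrict h (Pow X)"
  proof cases
    case (1 j)
    have "s \<otimes>\<^bsub>set_operators X\<^esub> t = (\<lambda>A\<in>Pow X. K j (g A))"
      using 1 words_subset[OF g(1)]
      by (auto simp: g(2) set_operators_def compose_def closure_op_def topspace_eq fun_eq_iff)
    then show ?thesis
      using words_absorb[OF g(1) 1(1)] by (intro that) auto
  next
    case (2 j)
    have "s \<otimes>\<^bsub>set_operators X\<^esub> t = (\<lambda>A\<in>Pow X. I j (g A))"
      using 2 words_subset[OF g(1)]
      by (auto simp: g(2) set_operators_def compose_def interior_op_def topspace_eq fun_eq_iff)
    then show ?thesis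
      using words_absorb[OF g(1) 2(1)] by (intro that) auto
  next
    case (3 j)
    have "s \<otimes>\<^bsub>set_operators X\<^esub> t = (\<lambda>A\<in>Pow X. F j (g A))"
      using 3 words_subset[OF g(1)]
      by (auto simp: g(2) set_operators_def compose_def frontier_op_def topspace_eq fun_eq_iff)
    then show ?thesis
      using words_absorb[OF g(1) 3(1)] by (intro that) auto
  qed
  then show "s \<otimes>\<^bsub>set_operators X\<^esub> t \<in> (\<lambda>g. restrict g (Pow X)) ` words"
    by blast
qed

lemma card_le_KF0: "card_le (KF0 X n \<tau>) (KF_bound n)"
  using card_le_subset[OF card_le_image[OF card_le_words] KF0_subset_words] .

section \<open>Adding the complement\<close>

abbreviation op_mult :: "('a set \<Rightarrow> 'a set) \<Rightarrow> ('a set \<Rightarrow> 'a set) \<Rightarrow> 'a set \<Rightarrow> 'a set"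
    (infixl "\<odot>" 70)
  where "g \<odot> h \<equiv> g \<otimes>\<^bsub>set_operators X\<^esub> h"

lemma complement_op_involutive:
  "g \<in> carrier (set_operators X) \<Longrightarrow> complement_op X \<odot> (complement_op X \<odot> g) = g"
  by (auto simp: set_operators_def compose_def complement_op_def fun_eq_iff PiE_iff
      extensional_def double_diff)

lemma generators_complement_op:
  assumes j: "j \<in> {1..n}"
  shows "closure_op (\<tau> j) \<odot> complement_op X = complement_op X \<odot> interior_op (\<tau> j)"
    and "frontier_op (\<tau> j) \<odot> complement_op X = frontier_op (\<tau> j)"
  using interior_of_subset_topspace[of "\<tau> j"] closure_compl[OF j] frontier_compl[OF j]
  by (auto simp: set_operators_def compose_def complement_op_def closure_op_def interior_op_def
      frontier_op_def topspace_eq[OF j] fun_eq_iff)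

text \<open>Interiors are recovered as \<open>i = c k c\<close>.\<close>

lemma KF0_subset_KF: "KF0 X n \<tau> \<subseteq> KF X n \<tau>"
proof -
  interpret M: monoid "set_operators X"
    by (rule monoid_set_operators)
  interpret KF: submonoid "KF X n \<tau>" "set_operators X"
    using submonoid_KF polytopological by blast
  have k: "closure_op (\<tau> j) \<in> KF X n \<tau>" and f: "frontier_op (\<tau> j) \<in> KF X n \<tau>"
    and c: "complement_op X \<in> KF X n \<tau>" if "j \<in> {1..n}" for j
    unfolding KF_def using that by (auto intro: hull_inc)
  have "interior_op (\<tau> j) \<in> KF X n \<tau>" if j: "j \<in> {1..n}" for j
  proof -
    have "interior_op (\<tau> j) = complement_op X \<odot> (closure_op (\<tau> j) \<odot> complement_op X)"
      using generators_complement_op(1)[OF j] generators_in_carrier(2)[OF j]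
      by (simp add: complement_op_involutive)
    then show ?thesis
      using k[OF j] c[OF j] by simp
  qed
  with k f show ?thesis
    unfolding KF0_def by (intro hull_minimal KF.is_submonoid) auto
qed

lemma KF_eq: "KF X n \<tau> = KF0 X n \<tau> \<union> (\<lambda>g. complement_op X \<odot> g) ` KF0 X n \<tau>"
proof
  let ?c = "complement_op X"
  interpret M: monoid "set_operators X"
    by (rule monoid_set_operators)
  interpret KF: submonoid "KF X n \<tau>" "set_operators X"
    using submonoid_KF polytopological by blast
  interpret KF0: submonoid "KF0 X n \<tau>" "set_operators X"
    using submonoid_KF polytopological by blast
  have c: "?c \<in> carrier (set_operators X)"
    by (rule generators_in_set_operators)
  have "?c \<in> KF X n \<tau>"
    unfolding KF_def by (simp add: hull_inc)
  then show "KF0 X n \<tau> \<union> (\<lambda>g. ?c \<odot> g) ` KF0 X n \<tau> \<subseteq> KF X n \<tau>"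
    using KF0_subset_KF by auto
  have k: "closure_op (\<tau> j) \<in> KF0 X n \<tau>" and i: "interior_op (\<tau> j) \<in> KF0 X n \<tau>"
    and f: "frontier_op (\<tau> j) \<in> KF0 X n \<tau>" if "j \<in> {1..n}" for j
    unfolding KF0_def using that by (auto intro: hull_inc)
  \<comment> \<open>Moving \<open>c\<close> to the left turns a closure into an interior, which is
    why \<open>KF0\<close> has interiors among its generators.\<close>
  have kc: "closure_op (\<tau> j) \<odot> (?c \<odot> g) = ?c \<odot> (interior_op (\<tau> j) \<odot> g)"
    and fc: "frontier_op (\<tau> j) \<odot> (?c \<odot> g) = frontier_op (\<tau> j) \<odot> g"
    if "j \<in> {1..n}" "g \<in> KF0 X n \<tau>" for j g
    using that c KF0.subset
    by (simp_all add: subset_iff generators_in_carrier generators_complement_op flip: M.m_assoc)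
  show "KF X n \<tau> \<subseteq> KF0 X n \<tau> \<union> (\<lambda>g. ?c \<odot> g) ` KF0 X n \<tau>"
    unfolding KF_def
  proof (rule submonoid_hull_subset[OF monoid_set_operators])
    fix s t
    assume "s \<in> (\<lambda>j. closure_op (\<tau> j)) ` {1..n} \<union> (\<lambda>j. frontier_op (\<tau> j)) ` {1..n} \<union> {?c}"
      and "t \<in> KF0 X n \<tau> \<union> (\<lambda>g. ?c \<odot> g) ` KF0 X n \<tau>"
    then consider j where "j \<in> {1..n}" "s = closure_op (\<tau> j)"
      | j where "j \<in> {1..n}" "s = frontier_op (\<tau> j)" | "s = ?c"
      by auto
    moreover obtain g where "g \<in> KF0 X n \<tau>" "t = g \<or> t = ?c \<odot> g"
      using \<open>t \<in> _\<close> by auto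
    ultimately show "s \<odot> t \<in> KF0 X n \<tau> \<union> (\<lambda>g. ?c \<odot> g) ` KF0 X n \<tau>"
      using KF0.subset by cases (auto simp: k i f kc fc complement_op_involutive)
  qed (use KF0.subset c generators_in_carrier in auto)
qed

text \<open>Separates \<open>KF0\<close> from its left translate by \<open>c\<close>, whose members
  send the empty set to \<open>X\<close>.\<close>

lemma KF0_empty:
  assumes "g \<in> KF0 X n \<tau>"
  shows "g {} = {}"
proof -
  have "KF0 X n \<tau> \<subseteq> {g \<in> carrier (set_operators X). g {} = {}}"
    unfolding KF0_def
  proof (rule submonoid_hull_subset[OF monoid_set_operators])
    fix s t
    assume s: "s \<in> (\<lambda>j. closure_op (\<tau> j)) ` {1..n} \<union> (\<lambda>j. interior_op (\<tau> j)) ` {1..n} \<union>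
        (\<lambda>j. frontier_op (\<tau> j)) ` {1..n}"
      and t: "t \<in> {g \<in> carrier (set_operators X). g {} = {}}"
    from s have "s \<in> carrier (set_operators X)"
      using generators_in_carrier by blast
    moreover have "s {} = {}"
      using s by (auto simp: closure_op_def interior_op_def frontier_op_def)
    ultimately show "s \<odot> t \<in> {g \<in> carrier (set_operators X). g {} = {}}"
      using t monoid.m_closed[OF monoid_set_operators, of s X t]
      by (auto simp: set_operators_def compose_def)
  next
    show "\<one>\<^bsub>set_operators X\<^esub> \<in> {g \<in> carrier (set_operators X). g {} = {}}"
      using monoid.one_closed[OF monoid_set_operators, of X] by (simp add: set_operators_def)
  qed (use generators_in_carrier in auto)
  with assms show ?thesis
    by blast
qed

text \<open>Left multiplication by \<open>c\<close> is injective, being its own inverse.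
  Nonemptiness of \<open>X\<close> makes the two halves disjoint; on the empty space there is just
  one set operator.\<close>

lemma card_KF:
  assumes "X \<noteq> {}"
  shows "card (KF X n \<tau>) = 2 * card (KF0 X n \<tau>)"
proof -
  let ?cKF0 = "(\<lambda>g. complement_op X \<odot> g) ` KF0 X n \<tau>"
  have "KF0 X n \<tau> \<subseteq> carrier (set_operators X)"
    using submonoid_KF(2)[OF polytopological] by (rule submonoid.subset)
  then have "inj_on (\<lambda>g. complement_op X \<odot> g) (KF0 X n \<tau>)"
    by (intro inj_on_inverseI[of _ "\<lambda>g. complement_op X \<odot> g"])
      (auto simp: complement_op_involutive)
  then have "card ?cKF0 = card (KF0 X n \<tau>)"
    by (rule card_image)
  moreover have "g {} = X" if "g \<in> ?cKF0" for g
    using that by (auto simp: set_operators_def compose_def complement_op_def KF0_empty)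
  then have "KF0 X n \<tau> \<inter> ?cKF0 = {}"
    using assms KF0_empty by fastforce
  moreover have "finite (KF0 X n \<tau>)"
    using card_le_KF0 by (simp add: card_le_def)
  ultimately show ?thesis
    by (simp add: KF_eq card_Un_disjoint)
qed

text \<open>Read off from the union in \<open>KF_eq\<close> without disjointness, so empty
  \<open>X\<close> is covered too.\<close>

lemma card_le_KF: "card_le (KF X n \<tau>) (2 * KF_bound n)"
  unfolding KF_eq mult_2 by (intro card_le_Un card_le_image card_le_KF0)

end

theorem theorem1p1:
  fixes X :: "'a set" and n :: nat and \<tau> :: "nat \<Rightarrow> 'a topology"
  assumes "polytopological_space X n \<tau>"
    and "saturated n \<tau>"
  shows "finite (KF0 X n \<tau>) \<and> real (card (KF0 X n \<tau>)) \<le> KF_bound n \<and>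
         finite (KF X n \<tau>) \<and>
         (X \<noteq> {} \<longrightarrow> card (KF X n \<tau>) = 2 * card (KF0 X n \<tau>)) \<and>
         real (card (KF X n \<tau>)) \<le> 2 * KF_bound n"
proof -
  interpret saturated_polytopology X n \<tau>
    using assms by unfold_locales
  show ?thesis
    using card_le_KF0 card_le_KF card_KF by (simp add: card_le_def)
qed

end
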